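(* For every integer $n\geq 1$ and every real $x$, $$\frac{d^{n}}{dx^{n}}\left(\arctan(x)\right)=\frac{(n-1)!}{(1+x^{2})^{n}}\operatorname{Im}\left((i-x)^{n}\right)=\frac{(n-1)!}{(1+x^{2})^{\frac{n+1}{2}}}\,U_{n-1}\left(\frac{-x}{\sqrt{1+x^{2}}}\right),$$ where $U_{n}$ is the $n$th Chebyshev polynomial of the second kind.
   Context: $\operatorname{Im}(z)$ denotes the imaginary part of the complex number $z$. The Chebyshev polynomial of the second kind $U_n$ is the polynomial of degree $n$ with $U_n(\cos\theta)=\sin((n+1)\theta)/\sin\theta$. *)

theory Defs
  imports "HOL-Analysis.Analysis" "HOL-Computational_Algebra.Polynomial"
begin

definition is_chebyshev_U :: "nat \<Rightarrow> real poly \<Rightarrow> bool" where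
  "is_chebyshev_U n p \<longleftrightarrow>
     degree p = n \<and>
     (\<forall>\<theta>::real. sin \<theta> \<noteq> 0 \<longrightarrow> poly p (cos \<theta>) = sin (real (n + 1) * \<theta>) / sin \<theta>)"

definition chebyshev_U :: "nat \<Rightarrow> real poly" where
  "chebyshev_U n = (THE p. is_chebyshev_U n p)"

text \<open>The description is proper: existence is by the three-term recurrence, and uniqueness holds
  because \<open>cos\<close> maps the set where \<open>sin\<close> does not vanish onto the open interval from \<open>-1\<close> to \<open>1\<close>.\<close>

lemma is_chebyshev_U_unique:
  assumes "is_chebyshev_U n p" "is_chebyshev_U n q"
  shows "p = q"
proof -
  have "poly (p - q) x = 0" if "x \<in> {-1<..<1}" for x :: real
  proof -
    have "sin (arccos x) \<noteq> 0"
      using that sin_arccos_nonzero by auto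
    moreover have "cos (arccos x) = x" using that by simp
    ultimately show ?thesis
      using assms unfolding is_chebyshev_U_def by (metis diff_self poly_diff)
  qed
  hence "{-1<..<1} \<subseteq> {x. poly (p - q) x = 0}" by blast
  moreover have "infinite {-1<..<1::real}" by simp
  ultimately have "infinite {x. poly (p - q) x = 0}" using finite_subset by blast
  hence "p - q = 0" by (metis poly_roots_finite)
  thus ?thesis by simp
qed

lemma is_chebyshev_U_0: "is_chebyshev_U 0 1"
  by (simp add: is_chebyshev_U_def)

lemma is_chebyshev_U_1: "is_chebyshev_U (Suc 0) [:0, 2:]"
  by (simp add: is_chebyshev_U_def sin_double)

lemma is_chebyshev_U_step:
  assumes p: "is_chebyshev_U n p" and q: "is_chebyshev_U (Suc n) q"
  shows "is_chebyshev_U (Suc (Suc n)) ([:0, 2:] * q - p)"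
  unfolding is_chebyshev_U_def
proof (intro conjI allI impI)
  have "q \<noteq> 0" using q by (auto simp: is_chebyshev_U_def)
  hence "degree ([:0, 2:] * q) = Suc (Suc n)"
    using q by (subst degree_mult_eq) (auto simp: is_chebyshev_U_def)
  moreover have "degree p = n" using p by (simp add: is_chebyshev_U_def)
  ultimately show "degree ([:0, 2:] * q - p) = Suc (Suc n)"
    using degree_add_eq_left[of "- p" "[:0, 2:] * q"] by simp
next
  fix \<theta> :: real
  assume s: "sin \<theta> \<noteq> 0"
  define a where "a = real (n + 2) * \<theta>"
  have "sin (a + \<theta>) = 2 * cos \<theta> * sin a - sin (a - \<theta>)"
    by (simp add: sin_add sin_diff)
  moreover have "real (Suc (Suc n) + 1) * \<theta> = a + \<theta>" "real (n + 1) * \<theta> = a - \<theta>"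
      "real (Suc n + 1) * \<theta> = a"
    by (simp_all add: a_def algebra_simps)
  ultimately show "poly ([:0, 2:] * q - p) (cos \<theta>)
      = sin (real (Suc (Suc n) + 1) * \<theta>) / sin \<theta>"
    using p q s by (simp add: is_chebyshev_U_def diff_divide_distrib)
qed

lemma is_chebyshev_U_exists: "\<exists>p. is_chebyshev_U n p"
proof -
  have "(\<exists>p. is_chebyshev_U n p) \<and> (\<exists>q. is_chebyshev_U (Suc n) q)"
  proof (induction n)
    case 0
    show ?case using is_chebyshev_U_0 is_chebyshev_U_1 by (intro conjI exI)
  next
    case (Suc n)
    then obtain p q where "is_chebyshev_U n p" and q: "is_chebyshev_U (Suc n) q" by (elim conjE exE)
    hence "is_chebyshev_U (Suc (Suc n)) ([:0, 2:] * q - p)" by (rule is_chebyshev_U_step)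
    with q show ?case by (intro conjI exI)
  qed
  thus ?thesis by (rule conjunct1)
qed

lemma is_chebyshev_U_chebyshev_U: "is_chebyshev_U n (chebyshev_U n)"
proof -
  obtain p where p: "is_chebyshev_U n p" using is_chebyshev_U_exists[of n] by (elim exE)
  show ?thesis
    unfolding chebyshev_U_def by (rule theI[where P = "is_chebyshev_U n", OF p], rule is_chebyshev_U_unique[OF _ p])
qed

end

theory Submission
  imports Defs
begin

text \<open>Put \<open>w(x) = (\<i> - x) / (1 + x\<^sup>2) = - 1 / (x + \<i>)\<close>. Then \<open>w' = w\<^sup>2\<close>, so
  \<open>(w\<^sup>n)' = n w\<^bsup>n+1\<^esup>\<close>, and \<open>Im w\<close> is the derivative of \<open>arctan\<close>. The Chebyshev
  form is de Moivre's formula for \<open>\<i> - x\<close>, whose modulus is \<open>sqrt (1 + x\<^sup>2)\<close> and whose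
  argument \<open>\<theta>\<close> satisfies \<open>sin \<theta> = 1 / sqrt (1 + x\<^sup>2)\<close>.\<close>

text \<open>The left form is convenient to differentiate, the right one is what the theorem speaks
  of; they agree since \<open>x + \<i>\<close> times \<open>\<i> - x\<close> is
  \<open>-(1 + x^2)\<close>.\<close>

lemma neg_inverse_add_ii:
  "- inverse (complex_of_real x + \<i>) = (\<i> - complex_of_real x) / of_real (1 + x\<^sup>2)"
proof -
  have "complex_of_real x + \<i> \<noteq> 0" "complex_of_real (1 + x\<^sup>2) \<noteq> 0"
    by (simp add: complex_eq_iff, metis add_pos_nonneg less_irrefl of_real_eq_0_iff zero_le_power2 zero_less_one)
  moreover have "(complex_of_real x + \<i>) * (\<i> - complex_of_real x) = - of_real (1 + x\<^sup>2)"
    by (simp add: algebra_simps power2_eq_square)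
  ultimately show ?thesis
    by (simp add: divide_simps del: of_real_add) (simp add: mult.commute)
qed

lemma Im_neg_inverse_add_ii_power:
  "Im ((- inverse (complex_of_real x + \<i>)) ^ n) = Im ((\<i> - complex_of_real x) ^ n) / (1 + x\<^sup>2) ^ n"
proof -
  have "(- inverse (complex_of_real x + \<i>)) ^ n = (\<i> - complex_of_real x) ^ n / of_real ((1 + x\<^sup>2) ^ n)"
    by (simp only: neg_inverse_add_ii power_divide of_real_power)
  thus ?thesis by (simp only: Im_divide_of_real)
qed

text \<open>Differentiate over the complex numbers, restrict to the real line, then apply
  \<open>Im\<close>, which as a bounded linear map commutes with the derivative.\<close>

lemma has_real_derivative_Im_neg_inverse_add_ii_power:
  "((\<lambda>x. Im ((- inverse (complex_of_real x + \<i>)) ^ n)) has_real_derivative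
     real n * Im ((- inverse (complex_of_real x + \<i>)) ^ Suc n)) (at x)"
proof -
  have "complex_of_real x + \<i> \<noteq> 0" by (simp add: complex_eq_iff)
  hence "((\<lambda>z. - inverse (z + \<i>)) has_field_derivative
      (- inverse (complex_of_real x + \<i>))\<^sup>2) (at (complex_of_real x))"
    by (auto intro!: derivative_eq_intros simp: power2_eq_square)
  from DERIV_power[OF this, of n]
  have "((\<lambda>z. (- inverse (z + \<i>)) ^ n) has_field_derivative
      of_nat n * (- inverse (complex_of_real x + \<i>)) ^ Suc n) (at (complex_of_real x))"
    \<comment> \<open>The power rule yields the truncated exponent \<open>n - 1\<close>; for
      \<open>n = 0\<close> the factor \<open>of_nat n\<close> makes both sides vanish.\<close>
    by (cases n) (simp_all add: power2_eq_square mult_ac)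
  hence "((\<lambda>x. (- inverse (complex_of_real x + \<i>)) ^ n) has_vector_derivative
      of_nat n * (- inverse (complex_of_real x + \<i>)) ^ Suc n) (at x)"
    by (rule has_vector_derivative_real_field)
  from bounded_linear.has_vector_derivative[OF bounded_linear_Im this] show ?thesis
    unfolding has_real_derivative_iff_has_vector_derivative by (simp del: power_Suc)
qed

lemma has_real_derivative_arctan_Im:
  "(arctan has_real_derivative Im (- inverse (complex_of_real x + \<i>))) (at x)"
  using DERIV_arctan[of x] Im_neg_inverse_add_ii_power[of x 1] by (simp add: inverse_eq_divide)

text \<open>An equation between functions, so that the induction step can apply \<open>deriv\<close>
  to it. The induction starts at the first derivative, as \<open>arctan\<close> itself is not of
  this form.\<close>

lemma higher_deriv_arctan:
  "(deriv ^^ Suc n) arctan = (\<lambda>x. fact n * Im ((- inverse (complex_of_real x + \<i>)) ^ Suc n))"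
proof (induction n)
  case 0
  show ?case using DERIV_imp_deriv[OF has_real_derivative_arctan_Im] by (simp add: fun_eq_iff)
next
  case (Suc n)
  have "deriv (\<lambda>x. fact n * Im ((- inverse (complex_of_real x + \<i>)) ^ Suc n)) x
      = fact (Suc n) * Im ((- inverse (complex_of_real x + \<i>)) ^ Suc (Suc n))" for x
    using DERIV_imp_deriv[OF DERIV_cmult[OF has_real_derivative_Im_neg_inverse_add_ii_power[of "Suc n" x], of "fact n"]]
    by (simp del: power_Suc add: mult_ac)
  with Suc show ?case by (simp del: power_Suc)
qed

text \<open>\<open>deriv\<close> has a value even where no derivative exists; this lemma ensures
  that the iterated \<open>deriv\<close> is a genuine derivative.\<close>

lemma higher_deriv_arctan_differentiable: "(deriv ^^ n) arctan differentiable (at x)"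
proof (cases n)
  case 0
  show ?thesis unfolding 0 using has_real_derivative_arctan_Im
    by (auto simp: real_differentiable_def)
next
  case (Suc m)
  show ?thesis unfolding Suc higher_deriv_arctan real_differentiable_def
    by (rule exI, rule DERIV_cmult, rule has_real_derivative_Im_neg_inverse_add_ii_power)
qed

text \<open>De Moivre's formula at the angle \<open>Arg z\<close>. Since \<open>Im z\<close> is
  nonzero, so is \<open>sin (Arg z)\<close>, and the defining identity of the Chebyshev polynomial
  applies; \<open>Im z\<close> absorbs this sine and one factor \<open>cmod z\<close>.\<close>

lemma Im_power_chebyshev_U:
  assumes "Im z \<noteq> 0"
  shows "Im (z ^ Suc n) = Im z * cmod z ^ n * poly (chebyshev_U n) (Re z / cmod z)"
proof -
  have "z \<noteq> 0" using assms by auto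
  hence r: "cmod z \<noteq> 0" by simp
  have z: "z = rcis (cmod z) (Arg z)" by (simp add: rcis_cmod_Arg)
  have re: "Re z = cmod z * cos (Arg z)" and im: "Im z = cmod z * sin (Arg z)"
    using arg_cong[OF z, of Re] arg_cong[OF z, of Im] by simp_all
  have "Im (z ^ Suc n) = cmod z ^ Suc n * sin (real (Suc n) * Arg z)"
    by (subst z) (simp only: DeMoivre2 Im_rcis)
  moreover have "sin (Arg z) \<noteq> 0" using assms im by auto
  moreover have "Re z / cmod z = cos (Arg z)" using re r by (simp add: field_simps)
  ultimately show ?thesis
    using is_chebyshev_U_chebyshev_U[of n] im by (simp add: is_chebyshev_U_def)
qed

theorem theorem9:
  fixes n :: nat and x :: real
  assumes "n \<ge> 1"
  shows "(deriv ^^ (n - 1)) arctan differentiable (at x)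
    \<and> (deriv ^^ n) arctan x
        = fact (n - 1) / (1 + x\<^sup>2) ^ n * Im ((\<i> - complex_of_real x) ^ n)
    \<and> fact (n - 1) / (1 + x\<^sup>2) ^ n * Im ((\<i> - complex_of_real x) ^ n)
        = fact (n - 1) / (1 + x\<^sup>2) powr ((real n + 1) / 2)
            * poly (chebyshev_U (n - 1)) (- x / sqrt (1 + x\<^sup>2))"
proof (intro conjI)
  obtain m where n: "n = Suc m" using assms by (cases n) auto
  show "(deriv ^^ (n - 1)) arctan differentiable (at x)"
    by (rule higher_deriv_arctan_differentiable)
  show "(deriv ^^ n) arctan x
      = fact (n - 1) / (1 + x\<^sup>2) ^ n * Im ((\<i> - complex_of_real x) ^ n)"
    unfolding n higher_deriv_arctan Im_neg_inverse_add_ii_power by simp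
  define r where "r = sqrt (1 + x\<^sup>2)"
  have r: "r > 0" "1 + x\<^sup>2 = r\<^sup>2" by (simp_all add: r_def add_pos_nonneg)
  have "cmod (\<i> - complex_of_real x) = r" by (simp add: cmod_def r_def add.commute)
  \<comment> \<open>Here \<open>Im z = 1\<close> and \<open>Re z = - x\<close>.\<close>
  hence "Im ((\<i> - complex_of_real x) ^ n) = r ^ m * poly (chebyshev_U m) (- x / r)"
    using Im_power_chebyshev_U[of "\<i> - complex_of_real x" m] unfolding n by simp
  moreover have "(1 + x\<^sup>2) powr ((real n + 1) / 2) = r ^ (m + 2)"
  proof -
    have "(1 + x\<^sup>2) powr ((real n + 1) / 2) = (r powr 2) powr ((real n + 1) / 2)"
      using r by simp
    also have "\<dots> = r powr real (m + 2)"
      unfolding powr_powr n by (rule arg_cong[where f = "(powr) r"]) simp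
    also have "\<dots> = r ^ (m + 2)" by (rule powr_realpow[OF r(1)])
    finally show ?thesis .
  qed
  \<comment> \<open>The exponent \<open>2 * n = 2 * m + 2\<close> is split so that
    \<open>r ^ m\<close> cancels against the factor from the Chebyshev form, leaving
    \<open>r ^ (m + 2)\<close>.\<close>
  moreover have "(1 + x\<^sup>2) ^ n = r ^ m * r ^ (m + 2)"
    unfolding r(2) n by (simp add: power_mult[symmetric] power_add[symmetric] flip: mult_2)
  ultimately show "fact (n - 1) / (1 + x\<^sup>2) ^ n * Im ((\<i> - complex_of_real x) ^ n)
      = fact (n - 1) / (1 + x\<^sup>2) powr ((real n + 1) / 2)
          * poly (chebyshev_U (n - 1)) (- x / sqrt (1 + x\<^sup>2))"
    using r(1) by (simp add: n r_def[symmetric])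
qed

end
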